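(* Let $0 = x_0 < x_1 < \cdots < x_n < \cdots$ be the sequence, in increasing order, of all nonnegative points at which the function $\mathrm{sinc}(x) = \sin(x)/x$ (with $\mathrm{sinc}(0)=1$) has a local maximum on $\mathbb{R}$. Then the sequence of values $1 = \mathrm{sinc}(x_0), \mathrm{sinc}(x_1), \dots, \mathrm{sinc}(x_n), \dots$ is decreasing, i.e. $\mathrm{sinc}(x_{n+1}) < \mathrm{sinc}(x_n)$ for all $n \ge 0$.
   Context: The function $\mathrm{sinc}:\mathbb{R}\to\mathbb{R}$ is defined by $\mathrm{sinc}(x)=\sin(x)/x$ for $x\neq 0$ and $\mathrm{sinc}(0)=1$. *)

theory Defs
  imports "HOL-Probability.Sinc_Integral"
begin

(* The function sinc is the one of HOL-Probability.Sinc_Integral,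
   an abbreviation for (\<lambda>x. if x = 0 then 1 else sin x / x) on the reals. *)

(* Non-strict local maximum; the neighbourhoods are those of the whole domain of f. *)
definition local_max_at :: "('a::topological_space \<Rightarrow> real) \<Rightarrow> 'a \<Rightarrow> bool" where
  "local_max_at f t \<longleftrightarrow> (\<forall>\<^sub>F s in nhds t. f s \<le> f t)"

end

theory Submission
  imports Defs
begin

text \<open>
  At a local maximum \<open>t > 0\<close> with value \<open>v\<close>, the function \<open>sin s - v s\<close> is at most \<open>0\<close> near \<open>t\<close> and
  vanishes at \<open>t\<close>. Its derivative there is zero, so \<open>cos t = v = sin t / t\<close> and
  \<open>v\<^sup>2 (1 + t\<^sup>2) = 1\<close>. Adding the inequalities at \<open>t + e\<close> and \<open>t - e\<close> gives
  \<open>sin t cos e \<le> sin t\<close>, so \<open>v \<ge> 0\<close>. Hence every nonnegative local maximum has the value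
  \<open>1 / sqrt (1 + t\<^sup>2)\<close>, which is strictly decreasing in \<open>t\<close>.
\<close>

text \<open>As \<open>|sin s| \<le> |s|\<close>, the value 1 at 0 is even a global maximum; this
  makes the enumeration start at 0.\<close>

lemma local_max_at_sinc_0: "local_max_at sinc 0"
proof -
  have "sinc s \<le> 1" for s
  proof (cases "s = 0")
    case False
    have "\<bar>sin s / s\<bar> \<le> 1"
      using abs_sin_x_le_abs_x[of s] False by (simp add: abs_divide)
    then have "sin s / s \<le> 1" by (rule abs_le_D1)
    with False show ?thesis by simp
  qed simp
  then show ?thesis
    by (simp add: local_max_at_def)
qed

lemma sinc_local_max_value:
  fixes t :: real
  assumes "0 \<le> t" and max: "local_max_at sinc t"
  shows "sinc t = 1 / sqrt (1 + t\<^sup>2)"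
proof (cases "t = 0")
  case False
  with \<open>0 \<le> t\<close> have t: "t > 0" by simp
  define v where "v = sin t / t"
  have vt: "v * t = sin t" using t by (simp add: v_def)
  \<comment> \<open>Keeping \<open>s > 0\<close> lets the denominator of \<open>sinc s\<close> be
    cleared without reversing the inequality.\<close>
  have "\<forall>\<^sub>F s in nhds t. sinc s \<le> sinc t \<and> s > 0"
    using max eventually_nhds_in_open[of "{0<..}" t] t
    by (auto simp: local_max_at_def eventually_conj_iff)
  then obtain d where d: "d > 0" and near: "\<And>s. \<bar>s - t\<bar> < d \<Longrightarrow> sinc s \<le> sinc t \<and> s > 0"
    by (auto simp: eventually_nhds_metric dist_real_def)
  have below: "sin s - v * s \<le> 0" if "\<bar>s - t\<bar> < d" for s
  proof -
    have "s > 0" "sin s / s \<le> v"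
      using near[OF that] t by (auto simp: v_def)
    then show ?thesis by (simp add: pos_divide_le_eq)
  qed
  have "((\<lambda>s. sin s - v * s) has_real_derivative cos t - v) (at t)"
    by (auto intro!: derivative_eq_intros)
  then have "cos t - v = 0"
    by (rule DERIV_local_max[OF _ d]) (use below vt in \<open>auto simp: abs_minus_commute\<close>)
  then have v: "cos t = v" by simp
  have "sin t \<ge> 0"
  proof (rule ccontr)
    assume neg: "\<not> sin t \<ge> 0"
    \<comment> \<open>\<open>e < d\<close> puts \<open>t + e\<close> and \<open>t - e\<close> within
      reach of \<open>below\<close>; \<open>0 < e \<le> 1 < pi\<close> gives
      \<open>cos e < 1\<close>.\<close>
    define e where "e = min (d / 2) 1"
    have e: "0 < e" "e < d" "e \<le> 1" using d by (auto simp: e_def)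
    have "sin (t + e) + sin (t - e) \<le> 2 * (v * t)"
      using below[of "t + e"] below[of "t - e"] e by (simp add: algebra_simps)
    then have "sin t * cos e \<le> sin t"
      by (simp add: vt sin_add sin_diff mult.commute[of "cos e"])
    \<comment> \<open>Cancelling the negative factor \<open>sin t\<close> reverses the
      inequality.\<close>
    with neg have "cos e \<ge> 1" by (simp add: mult_le_cancel_left1)
    moreover have "cos e < cos 0"
      using e pi_gt3 by (intro cos_monotone_0_pi) auto
    ultimately show False by simp
  qed
  then have "v \<ge> 0" using t by (simp add: v_def)
  \<comment> \<open>Substitute \<open>cos t = v\<close> and \<open>sin t = v * t\<close> into the
    Pythagorean identity.\<close>
  moreover have "v\<^sup>2 * (1 + t\<^sup>2) = 1"
    using sin_cos_squared_add[of t] by (simp add: v vt[symmetric] power_mult_distrib algebra_simps)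
  ultimately have "v * sqrt (1 + t\<^sup>2) = 1"
    by (metis real_sqrt_abs real_sqrt_mult real_sqrt_one abs_of_nonneg)
  moreover have "sqrt (1 + t\<^sup>2) \<noteq> 0"
    by (metis calculation mult_zero_right zero_neq_one)
  ultimately have "v = 1 / sqrt (1 + t\<^sup>2)"
    by (simp add: eq_divide_eq)
  then show ?thesis using t by (simp add: v_def)
qed simp

theorem mainTheorem1:
  fixes x :: "nat \<Rightarrow> real"
  assumes "strict_mono x"
    and "range x = {t. 0 \<le> t \<and> local_max_at sinc t}"
  shows "x 0 = 0 \<and> sinc (x 0) = 1 \<and> (\<forall>n. sinc (x (Suc n)) < sinc (x n))"
proof -
  have x: "0 \<le> x n" "local_max_at sinc (x n)" for n
    using assms(2) by blast+
  have "0 \<in> range x"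
    using assms(2) local_max_at_sinc_0 by simp
  then obtain k where "x k = 0" by (metis imageE)
  \<comment> \<open>Monotonicity gives \<open>x 0 \<le> x k = 0\<close>.\<close>
  then have x0: "x 0 = 0"
    using x(1)[of 0] strict_mono_less_eq[OF assms(1), of 0 k] by simp
  have "sinc (x (Suc n)) < sinc (x n)" for n
  proof -
    have "(x n)\<^sup>2 < (x (Suc n))\<^sup>2"
      using x(1) strict_monoD[OF assms(1), of n "Suc n"] by (intro power_strict_mono) auto
    then have "1 / sqrt (1 + (x (Suc n))\<^sup>2) < 1 / sqrt (1 + (x n)\<^sup>2)"
      by (intro divide_strict_left_mono mult_pos_pos) (auto simp: add_pos_nonneg)
    then show ?thesis
      by (simp only: sinc_local_max_value[OF x])
  qed
  with x0 show ?thesis by simp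
qed

end
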